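(* For $z=x+iy$ with $x\ge0$ and $y\in\mathbb{R}$, $$|\mathrm{erfc}(z)|\ge\frac{e^{y^2-x^2}}{\sqrt{(1+\sqrt\pi\,x)^2+\pi y^2}}\ge\frac{e^{y^2-x^2}}{1+\sqrt\pi\,|z|}\qquad\text{and}\qquad|\mathrm{erfc}(z)|\le e^{y^2-x^2}.$$
   Context: $\mathrm{erfc}$ is the (entire) complementary error function, $\mathrm{erfc}(z):=\frac{2}{\sqrt\pi}\int_z^\infty e^{-t^2}\,dt = 1-\frac{2}{\sqrt\pi}\int_0^z e^{-t^2}\,dt$ for $z\in\mathbb{C}$. *)

theory Defs
  imports "HOL-Complex_Analysis.Complex_Analysis" "HOL-Probability.Distributions"
begin

text \<open>
  The integrand is entire, so the choice of the straight segment from \<open>0\<close> to \<open>z\<close> is immaterial.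
  The lemma \<open>erfc_improper_integral\<close> below gives the form
  \<open>2 / sqrt pi * (integral from z to infinity of exp (- t\<^sup>2))\<close>.
\<close>

definition erfc :: "complex \<Rightarrow> complex" where
  "erfc z = 1 - of_real (2 / sqrt pi) * contour_integral (linepath 0 z) (\<lambda>t. exp (- t\<^sup>2))"

lemma erfc_improper_integral:
  "((\<lambda>R. of_real (2 / sqrt pi) * contour_integral (linepath z (of_real R)) (\<lambda>t. exp (- t\<^sup>2)))
     \<longlongrightarrow> erfc z) at_top"
proof -
  let ?f = "\<lambda>t::complex. exp (- t\<^sup>2)"
  let ?g = "\<lambda>x::real. exp (- x\<^sup>2)"
  have "?f holomorphic_on UNIV"
    by (intro holomorphic_intros)
  then obtain F where F: "\<And>t. (F has_field_derivative ?f t) (at t)"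
    using holomorphic_convex_primitive'[of UNIV ?f] by auto
  have prim: "contour_integral (linepath a b) ?f = F b - F a" for a b
    using contour_integral_primitive[of UNIV F ?f "linepath a b"] F
    by (auto intro!: contour_integral_unique)
  have gauss: "set_integrable lborel {0..} ?g" "set_lebesgue_integral lborel {0..} ?g = sqrt pi / 2"
    using gaussian_moment_0
    by (auto simp: set_integrable_def set_lebesgue_integral_def has_bochner_integral_iff)
  have lim: "((\<lambda>R. set_lebesgue_integral lborel {0..R} ?g) \<longlongrightarrow> sqrt pi / 2) at_top"
    using tendsto_set_lebesgue_integral_at_top[OF _ gauss(1)] gauss(2) by simp
  have seg: "F (of_real R) - F 0 = of_real (set_lebesgue_integral lborel {0..R} ?g)" if "R > 0" for R :: real
  proof -
    have "set_integrable lborel {0..R} ?g"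
      by (rule set_integrable_subset[OF gauss(1)]) auto
    then have "(?g has_integral set_lebesgue_integral lborel {0..R} ?g) {0..R}"
      by (metis set_borel_integral_eq_integral integrable_integral)
    then have "((\<lambda>x. complex_of_real (?g x)) has_integral
        of_real (set_lebesgue_integral lborel {0..R} ?g)) {0..R}"
      by (rule has_integral_of_real)
    then have "(?f has_contour_integral of_real (set_lebesgue_integral lborel {0..R} ?g))
        (linepath 0 (of_real R))"
      using that by (subst has_contour_integral_linepath_Reals_iff) (auto simp flip: exp_of_real)
    then show ?thesis
      using prim[of 0 "of_real R"] contour_integral_unique by metis
  qed
  have "((\<lambda>R. of_real (set_lebesgue_integral lborel {0..R} ?g)) \<longlongrightarrow> complex_of_real (sqrt pi / 2)) at_top"
    using lim by (rule tendsto_of_real)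
  moreover have "\<forall>\<^sub>F R in at_top.
      of_real (set_lebesgue_integral lborel {0..R} ?g) = F (of_real R) - F 0"
    using eventually_gt_at_top[of 0] by eventually_elim (simp only: seg)
  ultimately have "((\<lambda>R. F (of_real R) - F 0) \<longlongrightarrow> complex_of_real (sqrt pi / 2)) at_top"
    by (rule Lim_transform_eventually)
  then have "((\<lambda>R. of_real (2 / sqrt pi) * ((F (of_real R) - F 0) - (F z - F 0)))
      \<longlongrightarrow> of_real (2 / sqrt pi) * (complex_of_real (sqrt pi / 2) - (F z - F 0))) at_top"
    by (intro tendsto_intros)
  moreover have "of_real (2 / sqrt pi) * (complex_of_real (sqrt pi / 2) - (F z - F 0)) = erfc z"
    by (simp add: erfc_def prim right_diff_distrib flip: of_real_mult)
  ultimately show ?thesis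
    by (simp add: prim)
qed

end

theory Submission
  imports Defs
begin

text \<open>
  Since \<open>norm (exp (z\<^sup>2)) = exp (x\<^sup>2 - y\<^sup>2)\<close>, everything is a statement about
  \<open>f z = exp (z\<^sup>2) * erfc z\<close> (the constant \<open>erfcx\<close>) on the closed right half-plane: the outer bounds say
  \<open>1 \<le> norm ((1 + sqrt pi * z) * f z)\<close> and \<open>norm (f z) \<le> 1\<close>.

  The upper bound (\<open>norm_erfc_le\<close>) follows by integrating \<open>erfc' w = - 2 / sqrt pi * exp (- w\<^sup>2)\<close> along
  the horizontal ray from \<open>z\<close>, where \<open>norm (exp (- (z + s)\<^sup>2)) \<le> norm (exp (- z\<^sup>2)) * exp (- s\<^sup>2)\<close>.
  The same estimate applied to \<open>exp (- z\<^sup>2) / (sqrt pi * z) - erfc z\<close> gives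
  \<open>sqrt pi * z * f z \<longlongrightarrow> 1\<close> at infinity, uniformly in the half-plane (\<open>mult_erfcx_tendsto_1\<close>).

  The lower bound (\<open>norm_erfcx_ge\<close>) is the maximum principle for \<open>1 / ((1 + sqrt pi * z) * f z)\<close>, which
  tends to \<open>1\<close> at infinity. Two things have to be checked. First, \<open>f\<close> has no zeros: the maximum
  principle for \<open>exp (- f z)\<close> gives \<open>Re (f z) \<ge> 0\<close>, and the differential equation
  \<open>f' z = 2 * z * f z - 2 / sqrt pi\<close> would make \<open>Re f\<close> negative to the right of a zero
  (\<open>erfcx_nonzero\<close>). Second, the bound holds on the imaginary axis, where
  \<open>f (\<i> * t) = exp (- t\<^sup>2) * (1 - \<i> * erfi t)\<close>; there it becomes the real inequality
  \<open>1 + (erfi t)\<^sup>2 \<ge> exp (2 * t\<^sup>2) / (1 + pi * t\<^sup>2)\<close>. Differentiating it once, dividing by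
  \<open>exp (t\<^sup>2)\<close> and differentiating again removes both \<open>erfi\<close> and the exponentials, and what is left is
  a quadratic polynomial in \<open>pi * t\<^sup>2\<close> with negative discriminant (\<open>erfi_comparison\<close>).
\<close>

section \<open>The derivative of the complementary error function and its limit at infinity\<close>

lemma erfc_DERIV [derivative_intros]:
  assumes "(f has_field_derivative f') (at z within S)"
  shows "((\<lambda>z. erfc (f z)) has_field_derivative - of_real (2 / sqrt pi) * exp (- (f z)\<^sup>2) * f')
           (at z within S)"
proof -
  let ?g = "\<lambda>t::complex. exp (- t\<^sup>2)"
  have "?g holomorphic_on UNIV"
    by (intro holomorphic_intros)
  then obtain F where F: "\<And>t. (F has_field_derivative ?g t) (at t)"
    using holomorphic_convex_primitive'[of UNIV ?g] by auto
  have "contour_integral (linepath a b) ?g = F b - F a" for a b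
    using contour_integral_primitive[of UNIV F ?g "linepath a b"] F
    by (auto intro!: contour_integral_unique)
  then have "erfc = (\<lambda>w. 1 - of_real (2 / sqrt pi) * (F w - F 0))"
    by (simp add: erfc_def fun_eq_iff)
  moreover have "((\<lambda>w. 1 - of_real (2 / sqrt pi) * (F w - F 0)) has_field_derivative
                   - of_real (2 / sqrt pi) * ?g w) (at w)" for w
    by (auto intro!: derivative_eq_intros F)
  ultimately have "(erfc has_field_derivative - of_real (2 / sqrt pi) * ?g w) (at w)" for w
    by simp
  from DERIV_chain2[OF this assms] show ?thesis .
qed

lemma erfc_0 [simp]: "erfc 0 = 1"
  by (simp add: erfc_def)

lemma holomorphic_on_erfc: "erfc holomorphic_on A"
  unfolding holomorphic_on_def field_differentiable_def
  by (auto intro!: exI derivative_eq_intros)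

lemma norm_exp_neg_square:
  "norm (exp (- (z\<^sup>2))) = exp ((Im z)\<^sup>2 - (Re z)\<^sup>2)" for z :: complex
  by (simp add: Re_power2)

lemma erfc_of_real_tendsto_0: "((\<lambda>R. erfc (of_real R)) \<longlongrightarrow> 0) at_top"
proof -
  let ?I = "\<lambda>R::real. of_real (2 / sqrt pi)
              * contour_integral (linepath 0 (of_real R)) (\<lambda>t. exp (- t\<^sup>2))"
  have "((\<lambda>R. 1 - ?I R) \<longlongrightarrow> 1 - erfc 0) at_top"
    by (intro tendsto_intros erfc_improper_integral)
  then show ?thesis
    by (simp add: erfc_def)
qed

text \<open>
  On a vertical segment \<open>Re w = R\<close> the derivative of \<open>erfc\<close> is of size \<open>exp (- R\<^sup>2)\<close>, so the limit on
  the real axis carries over to every horizontal line.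
\<close>

lemma erfc_horizontal_tendsto_0: "((\<lambda>R. erfc (z + of_real R)) \<longlongrightarrow> 0) at_top"
proof -
  define x y where "x = Re z" and "y = Im z"
  let ?e = "\<lambda>R. 2 / sqrt pi * exp (y\<^sup>2 - (x + R)\<^sup>2) * \<bar>y\<bar>"
  have bound: "norm (erfc (z + of_real R) - erfc (of_real (x + R))) \<le> ?e R" for R
  proof -
    define S where "S = {w. Re w \<le> x + R} \<inter> {w. Re w \<ge> x + R}
                    \<inter> {w. Im w \<le> \<bar>y\<bar>} \<inter> {w. Im w \<ge> - \<bar>y\<bar>}"
    have "convex S"
      unfolding S_def
      by (intro convex_Int convex_halfspace_Re_le convex_halfspace_Re_ge
                convex_halfspace_Im_le convex_halfspace_Im_ge)
    moreover have "(erfc has_field_derivative - of_real (2 / sqrt pi) * exp (- w\<^sup>2)) (at w within S)"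
      for w
      by (auto intro!: derivative_eq_intros)
    moreover have "norm (- of_real (2 / sqrt pi) * exp (- w\<^sup>2))
                     \<le> 2 / sqrt pi * exp (y\<^sup>2 - (x + R)\<^sup>2)" if "w \<in> S" for w
    proof -
      have "Re w = x + R" "(Im w)\<^sup>2 \<le> y\<^sup>2"
        using that by (auto simp: S_def abs_le_square_iff[symmetric])
      then show ?thesis
        by (simp add: norm_mult norm_divide Re_power2 divide_right_mono)
    qed
    moreover have "z + of_real R \<in> S" "of_real (x + R) \<in> S"
      by (auto simp: S_def x_def y_def)
    ultimately have "norm (erfc (z + of_real R) - erfc (of_real (x + R)))
        \<le> 2 / sqrt pi * exp (y\<^sup>2 - (x + R)\<^sup>2) * norm (z + of_real R - of_real (x + R))"
      by (rule field_differentiable_bound)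
    moreover have "z + of_real R - of_real (x + R) = \<i> * of_real y"
      by (simp add: complex_eq_iff x_def y_def)
    ultimately show ?thesis
      by (simp add: norm_mult)
  qed
  have "(?e \<longlongrightarrow> 0) at_top"
    by real_asymp
  then have "((\<lambda>R. erfc (z + of_real R) - erfc (of_real (x + R))) \<longlongrightarrow> 0) at_top"
    by (rule Lim_null_comparison[rotated]) (use bound in auto)
  moreover have "((\<lambda>R. erfc (of_real (x + R))) \<longlongrightarrow> 0) at_top"
    by (rule filterlim_compose[OF erfc_of_real_tendsto_0]) real_asymp
  ultimately show ?thesis
    using tendsto_add by fastforce
qed

section \<open>Bounds by integration along a horizontal ray\<close>

text \<open>
  If \<open>H\<close> vanishes at the right end of the horizontal ray from \<open>z\<close> and \<open>h\<close> is its derivative, then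
  \<open>H z = - (integral of h along the ray)\<close>, and a Gaussian majorant of \<open>h\<close> contributes
  \<open>sqrt pi / 2\<close>. The proof compares \<open>H\<close> with the primitive \<open>sqrt pi / 2 * (1 - erfc s)\<close> of
  \<open>exp (- s\<^sup>2)\<close> on the real line.
\<close>

lemma norm_le_of_Gaussian_derivative:
  fixes H h :: "complex \<Rightarrow> complex"
  assumes deriv: "\<And>s::real. s \<ge> 0 \<Longrightarrow> (H has_field_derivative h (z + of_real s)) (at (z + of_real s))"
    and bound: "\<And>s::real. s \<ge> 0 \<Longrightarrow> norm (h (z + of_real s)) \<le> B * exp (- s\<^sup>2)"
    and lim: "((\<lambda>s::real. H (z + of_real s)) \<longlongrightarrow> 0) at_top"
  shows "norm (H z) \<le> B * (sqrt pi / 2)"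
proof -
  define \<phi> :: "real \<Rightarrow> real" where "\<phi> s = B * (sqrt pi / 2 * (1 - Re (erfc (of_real s))))" for s
  have erfc_real: "((\<lambda>s::real. erfc (of_real s)) has_vector_derivative
                     - of_real (2 / sqrt pi) * exp (- (of_real s)\<^sup>2)) (at s)" for s
    by (rule has_vector_derivative_real_field) (auto intro!: derivative_eq_intros)
  have \<phi>_deriv: "(\<phi> has_vector_derivative B * exp (- s\<^sup>2)) (at s)" for s
  proof -
    have "((\<lambda>s::real. Re (erfc (of_real s))) has_real_derivative - (2 / sqrt pi) * exp (- s\<^sup>2)) (at s)"
      using has_field_derivative_Re[OF erfc_real[of s]]
      by (simp add: Re_exp Re_power2 Im_power2)
    from DERIV_cmult[OF DERIV_cmult[OF DERIV_diff[OF DERIV_const this]], of B "sqrt pi / 2" 1]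
    show ?thesis
      unfolding \<phi>_def has_real_derivative_iff_has_vector_derivative[symmetric]
      by simp
  qed
  have H_deriv: "((\<lambda>s::real. H (z + of_real s)) has_vector_derivative h (z + of_real s)) (at s)"
    if "s \<ge> 0" for s
  proof -
    have "((\<lambda>w. H (z + w)) has_field_derivative h (z + of_real s)) (at (of_real s))"
      using DERIV_chain2[OF deriv[OF that] DERIV_add[OF DERIV_const DERIV_ident]] by simp
    then show ?thesis
      by (rule has_vector_derivative_real_field)
  qed
  have finite: "norm (H z - H (z + of_real R)) \<le> \<phi> R" if "R > 0" for R
  proof -
    have "norm (H (z + of_real R) - H (z + of_real 0)) \<le> \<phi> R - \<phi> 0"
    proof (rule differentiable_bound_general[OF that])
      show "continuous_on {0..R} (\<lambda>s. H (z + of_real s))"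
        by (rule continuous_on_vector_derivative)
          (auto intro: H_deriv has_vector_derivative_at_within)
      show "continuous_on {0..R} \<phi>"
        by (rule continuous_on_vector_derivative)
          (auto intro: \<phi>_deriv has_vector_derivative_at_within)
    qed (auto intro: H_deriv \<phi>_deriv bound)
    then show ?thesis
      by (simp add: \<phi>_def norm_minus_commute)
  qed
  have "(\<phi> \<longlongrightarrow> B * (sqrt pi / 2 * (1 - Re 0))) at_top"
    unfolding \<phi>_def by (intro tendsto_intros erfc_of_real_tendsto_0)
  moreover have "((\<lambda>R. norm (H z - H (z + of_real R))) \<longlongrightarrow> norm (H z - 0)) at_top"
    by (intro tendsto_intros lim)
  ultimately show ?thesis
    using tendsto_le[OF _ _ _ eventually_mono[OF eventually_gt_at_top[of 0] finite]]
    by fastforce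
qed

lemma norm_exp_neg_square_shift_le:
  assumes "Re z \<ge> 0" "s \<ge> 0"
  shows "norm (exp (- ((z + of_real s)\<^sup>2))) \<le> norm (exp (- (z\<^sup>2))) * exp (- s\<^sup>2)"
proof -
  have "2 * (Re z * s) \<ge> 0"
    using assms by simp
  then show ?thesis
    unfolding norm_exp_neg_square by (simp add: power2_sum flip: exp_add)
qed

lemma norm_erfc_le:
  assumes "Re z \<ge> 0"
  shows "norm (erfc z) \<le> norm (exp (- (z\<^sup>2)))"
proof -
  have "norm (erfc z) \<le> (2 / sqrt pi * norm (exp (- (z\<^sup>2)))) * (sqrt pi / 2)"
  proof (rule norm_le_of_Gaussian_derivative[where H = erfc and z = z
        and h = "\<lambda>w. - of_real (2 / sqrt pi) * exp (- w\<^sup>2)"])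
    fix s :: real assume "s \<ge> 0"
    show "(erfc has_field_derivative - of_real (2 / sqrt pi) * exp (- (z + of_real s)\<^sup>2))
            (at (z + of_real s))"
      by (auto intro!: derivative_eq_intros)
    show "norm (- of_real (2 / sqrt pi) * exp (- (z + of_real s)\<^sup>2))
            \<le> 2 / sqrt pi * norm (exp (- (z\<^sup>2))) * exp (- s\<^sup>2)"
      using norm_exp_neg_square_shift_le[OF assms \<open>s \<ge> 0\<close>]
      by (simp add: norm_mult norm_divide divide_right_mono del: norm_exp_eq_Re)
  qed (rule erfc_horizontal_tendsto_0)
  then show ?thesis
    by simp
qed

text \<open>
  The first term of the asymptotic expansion at infinity. The point is that differentiating
  \<open>exp (- z\<^sup>2) / (sqrt pi * z) - erfc z\<close> cancels the leading term and leaves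
  \<open>- exp (- z\<^sup>2) / (sqrt pi * z\<^sup>2)\<close>.
\<close>

lemma norm_erfc_asymptotic_error_le:
  assumes "Re z \<ge> 0" "z \<noteq> 0"
  shows "norm (exp (- (z\<^sup>2)) / (of_real (sqrt pi) * z) - erfc z)
           \<le> norm (exp (- (z\<^sup>2))) / (2 * (norm z)\<^sup>2)"
proof -
  let ?H = "\<lambda>w. exp (- (w\<^sup>2)) / (of_real (sqrt pi) * w) - erfc w"
  let ?h = "\<lambda>w. - exp (- (w\<^sup>2)) / (of_real (sqrt pi) * w\<^sup>2)"
  let ?B = "norm (exp (- (z\<^sup>2))) / (sqrt pi * (norm z)\<^sup>2)"
  have norm_ge: "norm (z + of_real s) \<ge> norm z" if "s \<ge> 0" for s :: real
    unfolding cmod_def using assms that by (auto intro!: real_sqrt_le_mono power_mono)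
  then have nz: "z + of_real s \<noteq> 0" if "s \<ge> 0" for s :: real
    using assms that by (metis norm_eq_zero norm_le_zero_iff)
  have "norm (?H z) \<le> ?B * (sqrt pi / 2)"
  proof (rule norm_le_of_Gaussian_derivative[where H = ?H and h = ?h and z = z])
    fix s :: real assume s: "s \<ge> 0"
    define w where "w = z + of_real s"
    define c where "c = complex_of_real (sqrt pi)"
    have "w \<noteq> 0" "c \<noteq> 0"
      using nz[OF s] by (auto simp: w_def c_def)
    have "(?H has_field_derivative
            (- (2 * w) * exp (- (w\<^sup>2)) * (c * w) - exp (- (w\<^sup>2)) * c) / ((c * w) * (c * w))
              - - (2 / c) * exp (- (w\<^sup>2))) (at w)"
      using \<open>w \<noteq> 0\<close> \<open>c \<noteq> 0\<close> unfolding c_def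
      by (auto intro!: derivative_eq_intros simp: algebra_simps)
    also have "(- (2 * w) * E * (c * w) - E * c) / ((c * w) * (c * w)) - - (2 / c) * E = - E / (c * w\<^sup>2)"
      for E :: complex
      using \<open>w \<noteq> 0\<close> \<open>c \<noteq> 0\<close> by (simp add: field_simps power2_eq_square)
    finally show "(?H has_field_derivative ?h (z + of_real s)) (at (z + of_real s))"
      by (simp add: w_def c_def)
    have "norm (exp (- ((z + of_real s)\<^sup>2))) / (sqrt pi * (norm (z + of_real s))\<^sup>2)
            \<le> (norm (exp (- (z\<^sup>2))) * exp (- s\<^sup>2)) / (sqrt pi * (norm z)\<^sup>2)"
      using norm_exp_neg_square_shift_le[OF assms(1) s] norm_ge[OF s] assms
      by (intro frac_le mult_left_mono power_mono) auto
    then show "norm (?h (z + of_real s)) \<le> ?B * exp (- s\<^sup>2)"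
      by (simp add: norm_divide norm_mult norm_power del: norm_exp_eq_Re)
  next
    have "((\<lambda>s::real. exp (- ((z + of_real s)\<^sup>2)) / (of_real (sqrt pi) * (z + of_real s))) \<longlongrightarrow> 0) at_top"
    proof (rule Lim_null_comparison)
      show "\<forall>\<^sub>F s::real in at_top. norm (exp (- ((z + of_real s)\<^sup>2)) / (of_real (sqrt pi) * (z + of_real s)))
              \<le> norm (exp (- (z\<^sup>2))) * exp (- s\<^sup>2) / (sqrt pi * norm z)"
        using eventually_ge_at_top[of 0]
      proof eventually_elim
        case (elim s)
        have "norm (exp (- ((z + of_real s)\<^sup>2))) / (sqrt pi * norm (z + of_real s))
            \<le> (norm (exp (- (z\<^sup>2))) * exp (- s\<^sup>2)) / (sqrt pi * norm z)"
          using norm_exp_neg_square_shift_le[OF assms(1) elim] norm_ge[OF elim] assms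
          by (intro frac_le mult_left_mono) auto
        then show ?case
          by (simp add: norm_divide norm_mult del: norm_exp_eq_Re)
      qed
      have "((\<lambda>s::real. exp (- s\<^sup>2)) \<longlongrightarrow> 0) at_top"
        by real_asymp
      from tendsto_mult[OF tendsto_const[of "norm (exp (- (z\<^sup>2))) / (sqrt pi * norm z)"] this]
      show "((\<lambda>s. norm (exp (- (z\<^sup>2))) * exp (- s\<^sup>2) / (sqrt pi * norm z)) \<longlongrightarrow> 0) at_top"
        by simp
    qed
    from tendsto_diff[OF this erfc_horizontal_tendsto_0[of z]]
    show "((\<lambda>s::real. ?H (z + of_real s)) \<longlongrightarrow> 0) at_top"
      by simp
  qed
  then show ?thesis
    by (simp add: field_simps)
qed

section \<open>The scaled function in the right half-plane\<close>

text \<open>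
  The scaled complementary error function, which is also the Faddeeva function at \<open>\<i> * z\<close>.
\<close>

definition erfcx :: "complex \<Rightarrow> complex" where
  "erfcx z = exp (z\<^sup>2) * erfc z"

lemma norm_erfc_eq: "norm (erfc z) = norm (exp (- (z\<^sup>2))) * norm (erfcx z)"
proof -
  have "erfc z = exp (- (z\<^sup>2)) * erfcx z"
    by (simp add: erfcx_def exp_minus)
  then show ?thesis
    by (metis norm_mult)
qed

lemma erfcx_DERIV:
  "(erfcx has_field_derivative 2 * z * erfcx z - of_real (2 / sqrt pi)) (at z within S)"
  unfolding erfcx_def
  by (auto intro!: derivative_eq_intros simp: exp_minus field_simps)

lemma holomorphic_on_erfcx: "erfcx holomorphic_on A"
  unfolding erfcx_def by (intro holomorphic_intros holomorphic_on_erfc)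

lemma continuous_on_erfcx: "continuous_on A erfcx"
  by (intro holomorphic_on_imp_continuous_on holomorphic_on_erfcx)

text \<open>
  The limit is along the trace of \<open>at_infinity\<close> on the closed half-plane, which is the form that the
  maximum principle below needs: it controls all directions, the imaginary ones included.
\<close>

lemma mult_erfcx_tendsto_1:
  "((\<lambda>z. of_real (sqrt pi) * z * erfcx z) \<longlongrightarrow> 1) (inf at_infinity (principal {z. Re z \<ge> 0}))"
proof -
  let ?F = "inf at_infinity (principal {z::complex. Re z \<ge> 0})"
  have "\<forall>\<^sub>F z in ?F. norm (of_real (sqrt pi) * z * erfcx z - 1) \<le> sqrt pi / 2 * norm (inverse z)"
    unfolding eventually_inf_principal eventually_at_infinity
  proof (intro exI[of _ 1] allI impI)
    fix z :: complex
    assume "1 \<le> norm z" and "z \<in> {z. Re z \<ge> 0}"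
    then have z: "z \<noteq> 0" "Re z \<ge> 0"
      by auto
    let ?e = "exp (- (z\<^sup>2))"
    have "of_real (sqrt pi) * z * erfcx z - 1
            = - (of_real (sqrt pi) * z * exp (z\<^sup>2)) * (?e / (of_real (sqrt pi) * z) - erfc z)"
      using z by (simp add: erfcx_def field_simps exp_minus)
    also have "norm \<dots> = sqrt pi * norm z * norm (exp (z\<^sup>2)) * norm (?e / (of_real (sqrt pi) * z) - erfc z)"
      by (simp add: norm_mult del: norm_exp_eq_Re)
    also have "\<dots> \<le> sqrt pi * norm z * norm (exp (z\<^sup>2)) * (norm ?e / (2 * (norm z)\<^sup>2))"
      by (intro mult_left_mono norm_erfc_asymptotic_error_le z) auto
    also have "\<dots> = (norm (exp (z\<^sup>2)) * norm ?e) * (sqrt pi / 2 * norm (inverse z))"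
      using z by (simp add: field_simps power2_eq_square norm_inverse norm_divide del: norm_exp_eq_Re)
    also have "norm (exp (z\<^sup>2)) * norm ?e = 1"
      by (simp flip: norm_mult exp_add del: norm_exp_eq_Re)
    finally show "norm (of_real (sqrt pi) * z * erfcx z - 1) \<le> sqrt pi / 2 * norm (inverse z)"
      by simp
  qed
  moreover have "((\<lambda>z::complex. sqrt pi / 2 * norm (inverse z)) \<longlongrightarrow> sqrt pi / 2 * norm (0::complex)) ?F"
    by (intro tendsto_intros tendsto_mono[OF inf_le1 tendsto_inverse_0])
  then have "((\<lambda>z::complex. sqrt pi / 2 * norm (inverse z)) \<longlongrightarrow> 0) ?F"
    by (simp only: norm_zero mult_zero_right)
  ultimately have "((\<lambda>z. of_real (sqrt pi) * z * erfcx z - 1) \<longlongrightarrow> 0) ?F"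
    by (rule Lim_null_comparison)
  then show ?thesis
    by (rule LIM_zero_cancel)
qed

lemma erfcx_tendsto_0: "(erfcx \<longlongrightarrow> 0) (inf at_infinity (principal {z. Re z \<ge> 0}))"
proof -
  let ?F = "inf at_infinity (principal {z::complex. Re z \<ge> 0})"
  have "((\<lambda>z. of_real (1 / sqrt pi) * inverse z * (of_real (sqrt pi) * z * erfcx z))
          \<longlongrightarrow> of_real (1 / sqrt pi) * 0 * 1) ?F"
    by (intro tendsto_intros mult_erfcx_tendsto_1 tendsto_mono[OF inf_le1 tendsto_inverse_0])
  moreover have "\<forall>\<^sub>F z in ?F. of_real (1 / sqrt pi) * inverse z * (of_real (sqrt pi) * z * erfcx z) = erfcx z"
    unfolding eventually_inf_principal eventually_at_infinity
    by (intro exI[of _ 1]) (auto simp: field_simps)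
  ultimately show ?thesis
    using Lim_transform_eventually by fastforce
qed

text \<open>
  The classical principle is applied to half-discs of growing radius: on the arc the limit at
  infinity bounds \<open>g\<close> by \<open>1 + e\<close>, on the diameter the hypothesis bounds it by \<open>1\<close>.
\<close>

lemma maximum_modulus_right_halfplane:
  assumes holo: "g holomorphic_on {z. Re z > 0}"
    and cont: "continuous_on {z. Re z \<ge> 0} g"
    and lim: "(g \<longlongrightarrow> l) (inf at_infinity (principal {z. Re z \<ge> 0}))" and l: "norm l \<le> 1"
    and axis: "\<And>z. Re z = 0 \<Longrightarrow> norm (g z) \<le> 1"
    and z: "Re z \<ge> 0"
  shows "norm (g z) \<le> 1"
proof (cases "Re z = 0")
  case False
  show ?thesis
  proof (rule field_le_epsilon)
    fix e :: real assume e: "e > 0"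
    have "((\<lambda>z. norm (g z)) \<longlongrightarrow> norm l) (inf at_infinity (principal {z. Re z \<ge> 0}))"
      by (intro tendsto_norm lim)
    then have "\<forall>\<^sub>F z in inf at_infinity (principal {z. Re z \<ge> 0}). norm (g z) < 1 + e"
      using l e by (intro order_tendstoD(2)[where y = "norm l"]) auto
    then obtain r where r: "\<And>w. norm w \<ge> r \<Longrightarrow> Re w \<ge> 0 \<Longrightarrow> norm (g w) < 1 + e"
      unfolding eventually_inf_principal eventually_at_infinity by auto
    define R where "R = max r (norm z + 1)"
    define S where "S = {w. Re w > 0} \<inter> ball 0 R"
    have "open S"
      unfolding S_def by (intro open_Int open_halfspace_Re_gt open_ball)
    have closure: "closure S \<subseteq> {w. Re w \<ge> 0} \<inter> cball 0 R"
    proof (rule closure_minimal)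
      show "S \<subseteq> {w. Re w \<ge> 0} \<inter> cball 0 R"
        unfolding S_def using ball_subset_cball by fastforce
      show "closed ({w. Re w \<ge> 0} \<inter> cball 0 R)"
        by (intro closed_Int closed_halfspace_Re_ge closed_cball)
    qed
    show "norm (g z) \<le> 1 + e"
    proof (rule maximum_modulus_frontier[where f = g and S = S and \<xi> = z])
      show "g holomorphic_on interior S"
        unfolding interior_open[OF \<open>open S\<close>]
        by (rule holomorphic_on_subset[OF holo]) (auto simp: S_def)
      show "continuous_on (closure S) g"
        using closure by (auto intro: continuous_on_subset[OF cont])
      show "bounded S"
        by (auto simp: S_def)
      show "z \<in> S"
        using z False by (auto simp: S_def R_def)
      fix w assume "w \<in> frontier S"
      then have "w \<in> closure S" "w \<notin> S"
        using \<open>open S\<close> by (auto simp: frontier_def interior_open)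
      then have "Re w \<ge> 0" "Re w = 0 \<or> norm w \<ge> R"
        using closure by (auto simp: S_def)
      then show "norm (g w) \<le> 1 + e"
        using r[of w] axis[of w] e by (auto simp: R_def)
    qed
  qed
qed (use axis in auto)

section \<open>The imaginary axis\<close>

text \<open>
  The imaginary error function \<open>2 / sqrt pi * (integral from 0 to t of exp (s\<^sup>2))\<close>, read off from
  \<open>erfc\<close> on the imaginary axis.
\<close>

definition erfi :: "real \<Rightarrow> real" where
  "erfi t = - Im (erfc (\<i> * of_real t))"

lemma erfc_ii_DERIV:
  "((\<lambda>t. erfc (\<i> * of_real t)) has_vector_derivative - of_real (2 / sqrt pi * exp (t\<^sup>2)) * \<i>) (at t)"
proof -
  have "((\<lambda>w. erfc (\<i> * w)) has_field_derivative
          - of_real (2 / sqrt pi) * exp (- (\<i> * of_real t)\<^sup>2) * \<i>) (at (of_real t))"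
    by (auto intro!: derivative_eq_intros)
  then show ?thesis
    by (auto dest!: has_vector_derivative_real_field
             simp: power_mult_distrib simp flip: exp_of_real of_real_power)
qed

lemma erfi_DERIV [derivative_intros]:
  assumes "(f has_real_derivative f') (at t within S)"
  shows "((\<lambda>t. erfi (f t)) has_real_derivative 2 / sqrt pi * exp ((f t)\<^sup>2) * f') (at t within S)"
proof -
  have "(erfi has_real_derivative 2 / sqrt pi * exp (u\<^sup>2)) (at u)" for u
    unfolding erfi_def
    using DERIV_minus[OF has_field_derivative_Im[OF erfc_ii_DERIV[of u]]] by simp
  from DERIV_chain2[OF this assms] show ?thesis .
qed

lemma erfc_ii: "erfc (\<i> * of_real t) = 1 - \<i> * of_real (erfi t)"
proof -
  have "((\<lambda>t. Re (erfc (\<i> * of_real t))) has_real_derivative 0) (at u)" for u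
    using has_field_derivative_Re[OF erfc_ii_DERIV[of u]] by simp
  then have "Re (erfc (\<i> * of_real t)) = Re (erfc (\<i> * of_real 0))"
    by (intro DERIV_isconst_all) auto
  then show ?thesis
    by (simp add: complex_eq_iff erfi_def)
qed

lemma erfi_0 [simp]: "erfi 0 = 0"
  by (simp add: erfi_def)

text \<open>
  For \<open>v = pi * t\<^sup>2\<close> the sign of this quadratic polynomial decides the comparison below. Its
  discriminant is negative already for the rounded coefficients in the proof.
\<close>

lemma erfi_comparison_polynomial_nonneg:
  fixes v :: real
  assumes "v \<ge> 0"
  shows "(8 + 8 * pi) * v\<^sup>2 + (16 + 4 * pi - 6 * pi\<^sup>2) * v + (8 - 4 * pi + 2 * pi\<^sup>2) \<ge> 0"
proof -
  have pi: "3 < pi" "pi < 16 / 5"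
    using pi_approx by auto
  then have pi2: "9 \<le> pi\<^sup>2" "pi\<^sup>2 \<le> 256 / 25"
    using power_mono[of 3 pi 2] power_mono[of pi "16 / 5" 2] by (auto simp: power2_eq_square)
  have "(pi - 1)\<^sup>2 \<ge> 2\<^sup>2"
    using pi by (intro power_mono) auto
  then have "8 - 4 * pi + 2 * pi\<^sup>2 \<ge> 14"
    by (simp add: power2_eq_square algebra_simps)
  moreover have "(8 + 8 * pi) * v\<^sup>2 \<ge> 32 * v\<^sup>2"
    using pi by (intro mult_right_mono) auto
  moreover have "(16 + 4 * pi - 6 * pi\<^sup>2) * v \<ge> - 36 * v"
    using pi pi2 assms by (intro mult_right_mono) auto
  moreover have "32 * v\<^sup>2 - 36 * v + 14 \<ge> 0"
    using zero_le_power2[of "16 * v - 9"] by (simp add: power2_eq_square algebra_simps)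
  ultimately show ?thesis
    by linarith
qed

text \<open>
  The subtracted function is the one for which the derivative of
  \<open>1 + (erfi t)\<^sup>2 - exp (2 * t\<^sup>2) / (1 + pi * t\<^sup>2)\<close> becomes a positive multiple of \<open>W t\<close>. Since both
  terms of \<open>W\<close> carry the factor \<open>exp (t\<^sup>2)\<close> after one differentiation, \<open>W\<close> is increasing by a purely
  rational inequality.
\<close>

lemma erfi_comparison:
  defines "W \<equiv> \<lambda>t. erfi t - sqrt pi / 2 * (exp (t\<^sup>2) * (t * (2 - pi + 2 * pi * t\<^sup>2) / (1 + pi * t\<^sup>2)\<^sup>2))"
  shows "t \<ge> 0 \<Longrightarrow> W t \<ge> 0" and "t \<le> 0 \<Longrightarrow> W t \<le> 0"
proof -
  define q where "q t = t * (2 - pi + 2 * pi * t\<^sup>2) / (1 + pi * t\<^sup>2)\<^sup>2" for t :: real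
  define P where "P v = (8 + 8 * pi) * v\<^sup>2 + (16 + 4 * pi - 6 * pi\<^sup>2) * v + (8 - 4 * pi + 2 * pi\<^sup>2)"
    for v :: real
  have W_deriv: "(W has_real_derivative exp (u\<^sup>2) * (P (pi * u\<^sup>2) / (4 * sqrt pi * (1 + pi * u\<^sup>2) ^ 3))) (at u)"
    for u
  proof -
    define v where "v = pi * u\<^sup>2"
    define D where "D = 1 + v"
    define q' where "q' = (2 - pi + 6 * v) / D\<^sup>2 - 4 * v * (2 - pi + 2 * v) / D ^ 3"
    have D: "D > 0"
      by (auto simp: D_def v_def intro!: add_pos_nonneg)
    have D_eq: "1 + pi * u\<^sup>2 = D"
      by (simp add: D_def v_def)
    have "((\<lambda>t. t * (2 - pi + 2 * pi * t\<^sup>2)) has_real_derivative 2 - pi + 6 * v) (at u)"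
      unfolding v_def by (auto intro!: derivative_eq_intros simp: algebra_simps power2_eq_square)
    moreover have "((\<lambda>t. (1 + pi * t\<^sup>2)\<^sup>2) has_real_derivative 4 * pi * u * D) (at u)"
      by (auto intro!: derivative_eq_intros simp: D_eq)
    ultimately have "(q has_real_derivative
        ((2 - pi + 6 * v) * D\<^sup>2 - u * (2 - pi + 2 * pi * u\<^sup>2) * (4 * pi * u * D)) / (D\<^sup>2 * D\<^sup>2)) (at u)"
      unfolding q_def D_eq[symmetric] using D by (intro DERIV_divide) (auto simp: D_eq)
    also have "((2 - pi + 6 * v) * D\<^sup>2 - u * (2 - pi + 2 * pi * u\<^sup>2) * (4 * pi * u * D)) / (D\<^sup>2 * D\<^sup>2) = q'"
    proof -
      have "u * (2 - pi + 2 * pi * u\<^sup>2) * (4 * pi * u * D) = 4 * v * (2 - pi + 2 * v) * D"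
        by (simp add: v_def power2_eq_square)
      moreover have "(X * D\<^sup>2 - Y * D) / (D\<^sup>2 * D\<^sup>2) = X / D\<^sup>2 - Y / D ^ 3" for X Y
        using D by (simp add: diff_divide_distrib power2_eq_square power3_eq_cube)
      ultimately show ?thesis
        by (simp only: q'_def)
    qed
    finally have q_deriv: "(q has_real_derivative q') (at u)" .
    have unsimplified: "(W has_real_derivative
        2 / sqrt pi * exp (u\<^sup>2) - sqrt pi / 2 * (exp (u\<^sup>2) * (2 * u * q u + q'))) (at u)"
      unfolding W_def q_def[symmetric]
      by (auto intro!: derivative_eq_intros q_deriv simp: algebra_simps)
    have rational: "4 / pi - (2 * u * q u + q') = P v / (2 * pi * D ^ 3)"
    proof -
      have "pi * (2 * u * q u) = 2 * v * (2 - pi + 2 * v) / D\<^sup>2"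
        by (simp add: q_def D_eq) (simp add: v_def power2_eq_square)
      then have "pi * (2 * u * q u) * D ^ 3 = 2 * v * (2 - pi + 2 * v) / D\<^sup>2 * D ^ 3"
        by (simp only:)
      then have "pi * D ^ 3 * (2 * u * q u) = 2 * v * (2 - pi + 2 * v) * D"
        using D by (simp add: power2_eq_square power3_eq_cube mult_ac)
      moreover have "pi * D ^ 3 * q' = pi * ((2 - pi + 6 * v) * D - 4 * v * (2 - pi + 2 * v))"
        unfolding q'_def using D by (simp add: power2_eq_square power3_eq_cube right_diff_distrib)
      moreover have "pi * D ^ 3 * (4 / pi) = 4 * D ^ 3"
        by simp
      ultimately have "2 * (pi * D ^ 3 * (4 / pi - (2 * u * q u + q')))
          = 2 * (4 * D ^ 3 - (2 * v * (2 - pi + 2 * v) * D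
                  + pi * ((2 - pi + 6 * v) * D - 4 * v * (2 - pi + 2 * v))))"
        by (simp only: right_diff_distrib distrib_left)
      also have "\<dots> = P v"
        unfolding P_def D_def by (simp add: algebra_simps power2_eq_square power3_eq_cube)
      finally show ?thesis
        using D by (simp add: eq_divide_eq mult_ac)
    qed
    have "2 / sqrt pi = sqrt pi / 2 * (4 / pi)"
      by (simp add: field_simps)
    then have "2 / sqrt pi * e - sqrt pi / 2 * (e * X) = e * (sqrt pi / 2 * (4 / pi - X))" for e X :: real
      by (simp only: right_diff_distrib mult_ac)
    note this[of "exp (u\<^sup>2)" "2 * u * q u + q'"]
    also note rational
    also have "sqrt pi / 2 * (P v / (2 * pi * D ^ 3)) = (sqrt pi / pi) * (P v / (4 * D ^ 3))"
      by simp
    also have "sqrt pi / pi = 1 / sqrt pi"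
      by (simp add: field_simps)
    also have "1 / sqrt pi * (P v / (4 * D ^ 3)) = P v / (4 * sqrt pi * D ^ 3)"
      by simp
    finally show ?thesis
      using unsimplified by (simp only: D_eq v_def)
  qed
  have "exp (u\<^sup>2) * (P (pi * u\<^sup>2) / (4 * sqrt pi * (1 + pi * u\<^sup>2) ^ 3)) \<ge> 0" for u
    using erfi_comparison_polynomial_nonneg[of "pi * u\<^sup>2"] by (auto simp: P_def)
  with W_deriv have "\<exists>d. DERIV W u :> d \<and> d \<ge> 0" for u
    by blast
  then have "W a \<le> W b" if "a \<le> b" for a b
    by (rule DERIV_nonneg_imp_nondecreasing[OF that])
  moreover have "W 0 = 0"
    by (simp add: W_def)
  ultimately show "t \<ge> 0 \<Longrightarrow> W t \<ge> 0" "t \<le> 0 \<Longrightarrow> W t \<le> 0"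
    by metis+
qed

text \<open>
  Equality holds at \<open>0\<close>, and by the previous comparison the difference of the two sides decreases
  before \<open>0\<close> and increases after it.
\<close>

lemma one_plus_erfi_square_ge: "1 + (erfi t)\<^sup>2 \<ge> exp (2 * t\<^sup>2) / (1 + pi * t\<^sup>2)"
proof -
  define W where
    "W u = erfi u - sqrt pi / 2 * (exp (u\<^sup>2) * (u * (2 - pi + 2 * pi * u\<^sup>2) / (1 + pi * u\<^sup>2)\<^sup>2))" for u
  define G where "G u = 1 + (erfi u)\<^sup>2 - exp (2 * u\<^sup>2) / (1 + pi * u\<^sup>2)" for u
  have G_deriv: "(G has_real_derivative 4 / sqrt pi * exp (u\<^sup>2) * W u) (at u)" for u
  proof -
    define D where "D = 1 + pi * u\<^sup>2"
    have D: "D > 0"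
      by (auto simp: D_def intro!: add_pos_nonneg)
    have "(G has_real_derivative 2 * erfi u * (2 / sqrt pi * exp (u\<^sup>2))
            - exp (2 * u\<^sup>2) * (4 * u / D - 2 * pi * u / D\<^sup>2)) (at u)"
      unfolding G_def using D
      by (auto intro!: derivative_eq_intros simp flip: D_def)
         (simp add: field_simps power2_eq_square)
    moreover have "4 * u / D - 2 * pi * u / D\<^sup>2 = 2 * (u * (2 - pi + 2 * pi * u\<^sup>2) / D\<^sup>2)"
    proof -
      have "4 * u / D - 2 * pi * u / D\<^sup>2 = (4 * u * D - 2 * pi * u) / D\<^sup>2"
        using D by (simp add: field_simps power2_eq_square)
      also have "4 * u * D - 2 * pi * u = 2 * (u * (2 - pi + 2 * pi * u\<^sup>2))"
        by (simp add: D_def algebra_simps)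
      finally show ?thesis
        by simp
    qed
    moreover have "exp (2 * u\<^sup>2) = exp (u\<^sup>2) * exp (u\<^sup>2)"
      by (simp flip: exp_add)
    moreover have "2 * a * (2 / sqrt pi * e) - e * e * (2 * X) = 4 / sqrt pi * e * (a - sqrt pi / 2 * (e * X))"
      for a e X :: real
      by (simp add: field_simps)
    ultimately show ?thesis
      by (simp only: W_def D_def)
  qed
  have "G t \<ge> G 0"
  proof (cases "t \<ge> 0")
    case True
    have "4 / sqrt pi * exp (u\<^sup>2) * W u \<ge> 0" if "u \<ge> 0" for u
      using erfi_comparison(1)[OF that] unfolding W_def by (intro mult_nonneg_nonneg) auto
    with G_deriv True show ?thesis
      by (intro DERIV_nonneg_imp_nondecreasing[OF True]) blast
  next
    case False
    then have "t \<le> 0"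
      by simp
    have "4 / sqrt pi * exp (u\<^sup>2) * W u \<le> 0" if "u \<le> 0" for u
      using erfi_comparison(2)[OF that] unfolding W_def by (intro mult_nonneg_nonpos) auto
    with G_deriv show ?thesis
      by (intro DERIV_nonpos_imp_nonincreasing[OF \<open>t \<le> 0\<close>]) blast
  qed
  then show ?thesis
    by (simp add: G_def)
qed

lemma erfcx_ii: "erfcx (\<i> * of_real t) = of_real (exp (- t\<^sup>2)) * (1 - \<i> * of_real (erfi t))"
  by (simp add: erfcx_def erfc_ii power_mult_distrib exp_of_real[symmetric])

lemma norm_erfcx_ii_ge:
  "norm ((1 + of_real (sqrt pi) * (\<i> * of_real t)) * erfcx (\<i> * of_real t)) \<ge> 1"
proof -
  have D: "1 + pi * t\<^sup>2 > 0"
    by (auto intro!: add_pos_nonneg)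
  have "(norm ((1 + of_real (sqrt pi) * (\<i> * of_real t)) * erfcx (\<i> * of_real t)))\<^sup>2
          = (1 + pi * t\<^sup>2) * ((exp (- t\<^sup>2))\<^sup>2 * (1 + (erfi t)\<^sup>2))"
    unfolding erfcx_ii norm_mult power_mult_distrib
    by (simp add: cmod_power2 power_mult_distrib)
  also have "\<dots> \<ge> (1 + pi * t\<^sup>2) * ((exp (- t\<^sup>2))\<^sup>2 * (exp (2 * t\<^sup>2) / (1 + pi * t\<^sup>2)))"
    using D by (intro mult_left_mono one_plus_erfi_square_ge) auto
  also have "(1 + pi * t\<^sup>2) * ((exp (- t\<^sup>2))\<^sup>2 * (exp (2 * t\<^sup>2) / (1 + pi * t\<^sup>2))) = 1"
    using D by (simp flip: exp_double exp_add)
  finally have "1\<^sup>2 \<le> (norm ((1 + of_real (sqrt pi) * (\<i> * of_real t)) * erfcx (\<i> * of_real t)))\<^sup>2"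
    unfolding power_one .
  then show ?thesis
    by (rule power2_le_imp_le) (rule norm_ge_zero)
qed

section \<open>The lower bound\<close>

text \<open>
  The maximum principle is applied to \<open>exp (- erfcx z)\<close>, whose modulus is \<open>exp (- Re (erfcx z))\<close>. On
  the imaginary axis the real part is \<open>exp (- t\<^sup>2) > 0\<close>, and at infinity \<open>erfcx\<close> vanishes.
\<close>

lemma Re_erfcx_nonneg:
  assumes "Re z \<ge> 0"
  shows "Re (erfcx z) \<ge> 0"
proof -
  have "norm (exp (- erfcx z)) \<le> 1"
  proof (rule maximum_modulus_right_halfplane[OF _ _ _ _ _ assms])
    show "(\<lambda>z. exp (- erfcx z)) holomorphic_on {z. Re z > 0}"
      by (intro holomorphic_intros holomorphic_on_erfcx)
    show "continuous_on {z. Re z \<ge> 0} (\<lambda>z. exp (- erfcx z))"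
      by (intro continuous_intros continuous_on_erfcx)
    show "((\<lambda>z. exp (- erfcx z)) \<longlongrightarrow> exp (- 0)) (inf at_infinity (principal {z. Re z \<ge> 0}))"
      by (intro tendsto_intros erfcx_tendsto_0)
    fix w :: complex assume "Re w = 0"
    then have "w = \<i> * of_real (Im w)"
      by (simp add: complex_eq_iff)
    then have "erfcx w = of_real (exp (- (Im w)\<^sup>2)) * (1 - \<i> * of_real (erfi (Im w)))"
      by (metis erfcx_ii)
    then show "norm (exp (- erfcx w)) \<le> 1"
      by simp
  qed auto
  then show ?thesis
    by simp
qed

text \<open>
  At a zero the derivative \<open>2 * z * erfcx z - 2 / sqrt pi\<close> is the negative real \<open>- 2 / sqrt pi\<close>, so
  just to the right of a zero the real part would be negative.
\<close>

lemma erfcx_nonzero: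
  assumes "Re z \<ge> 0"
  shows "erfcx z \<noteq> 0"
proof
  assume zero: "erfcx z = 0"
  have "((\<lambda>w. erfcx (z + w)) has_field_derivative - of_real (2 / sqrt pi)) (at (of_real 0))"
    using DERIV_chain2[OF erfcx_DERIV DERIV_add[OF DERIV_const DERIV_ident], of z 0] by (simp add: zero)
  then have "((\<lambda>s::real. Re (erfcx (z + of_real s))) has_real_derivative - (2 / sqrt pi)) (at 0)"
    using has_field_derivative_Re[OF has_vector_derivative_real_field] by fastforce
  then obtain d where d: "d > 0"
    "\<And>h. h > 0 \<Longrightarrow> h < d \<Longrightarrow> Re (erfcx (z + of_real h)) < Re (erfcx z)"
    using DERIV_neg_dec_right[of "\<lambda>s. Re (erfcx (z + of_real s))" "- (2 / sqrt pi)" 0] by auto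
  have "Re (erfcx (z + of_real (d / 2))) < Re (erfcx z)"
    using d(1) by (intro d(2)) auto
  moreover have "Re (erfcx (z + of_real (d / 2))) \<ge> 0"
    using d(1) assms by (intro Re_erfcx_nonneg) simp
  ultimately show False
    by (simp add: zero)
qed

lemma norm_erfcx_ge:
  assumes "Re z \<ge> 0"
  shows "norm ((1 + of_real (sqrt pi) * z) * erfcx z) \<ge> 1"
proof -
  let ?f = "\<lambda>z. (1 + of_real (sqrt pi) * z) * erfcx z"
  let ?F = "inf at_infinity (principal {z::complex. Re z \<ge> 0})"
  have nz: "?f w \<noteq> 0" if "Re w \<ge> 0" for w
  proof -
    have "Re (1 + of_real (sqrt pi) * w) > 0"
      using that by (simp add: add_pos_nonneg)
    then have "1 + of_real (sqrt pi) * w \<noteq> 0"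
      by fastforce
    with erfcx_nonzero[OF that] show ?thesis
      by simp
  qed
  have "norm (inverse (?f z)) \<le> 1"
  proof (rule maximum_modulus_right_halfplane[OF _ _ _ _ _ assms])
    show "(\<lambda>z. inverse (?f z)) holomorphic_on {z. Re z > 0}"
      using nz by (intro holomorphic_intros holomorphic_on_erfcx) auto
    show "continuous_on {z. Re z \<ge> 0} (\<lambda>z. inverse (?f z))"
      using nz by (intro continuous_intros continuous_on_erfcx) auto
    have "((\<lambda>z. erfcx z + of_real (sqrt pi) * z * erfcx z) \<longlongrightarrow> 0 + 1) ?F"
      by (intro tendsto_intros erfcx_tendsto_0 mult_erfcx_tendsto_1)
    then have "(?f \<longlongrightarrow> 1) ?F"
      by (simp add: algebra_simps)
    then show "((\<lambda>z. inverse (?f z)) \<longlongrightarrow> inverse 1) ?F"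
      by (intro tendsto_intros) auto
    fix w :: complex assume "Re w = 0"
    then have "w = \<i> * of_real (Im w)"
      by (simp add: complex_eq_iff)
    then have "norm (?f w) \<ge> 1"
      by (metis norm_erfcx_ii_ge)
    then show "norm (inverse (?f w)) \<le> 1"
      unfolding norm_inverse by (rule inverse_le_1_iff[THEN iffD2, OF disjI2])
  qed auto
  then show ?thesis
    using nz[OF assms] unfolding norm_inverse inverse_le_1_iff by (simp del: mult_eq_0_iff)
qed

theorem theorem6:
  fixes x y :: real and z :: complex
  assumes "z = of_real x + \<i> * of_real y" and "x \<ge> 0"
  shows "norm (erfc z) \<ge> exp (y\<^sup>2 - x\<^sup>2) / sqrt ((1 + sqrt pi * x)\<^sup>2 + pi * y\<^sup>2)
    \<and> exp (y\<^sup>2 - x\<^sup>2) / sqrt ((1 + sqrt pi * x)\<^sup>2 + pi * y\<^sup>2)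
        \<ge> exp (y\<^sup>2 - x\<^sup>2) / (1 + sqrt pi * norm z)
    \<and> norm (erfc z) \<le> exp (y\<^sup>2 - x\<^sup>2)"
proof -
  let ?q = "1 + of_real (sqrt pi) * z"
  have z: "Re z = x" "Im z = y"
    using assms(1) by auto
  have e: "norm (exp (- (z\<^sup>2))) = exp (y\<^sup>2 - x\<^sup>2)"
    unfolding norm_exp_neg_square z ..
  have q: "norm ?q = sqrt ((1 + sqrt pi * x)\<^sup>2 + pi * y\<^sup>2)"
    unfolding cmod_def by (simp add: z power_mult_distrib)
  have "1 + sqrt pi * x > 0"
    using assms(2) by (simp add: add_pos_nonneg)
  then have q_pos: "norm ?q > 0"
    unfolding q by (simp add: add_pos_nonneg)
  have "1 / norm ?q \<le> norm (erfcx z)"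
    using norm_erfcx_ge[of z] assms(2) z q_pos
    by (simp add: norm_mult pos_divide_le_eq mult.commute)
  then have "exp (y\<^sup>2 - x\<^sup>2) * (1 / norm ?q) \<le> norm (erfc z)"
    unfolding norm_erfc_eq e by (intro mult_left_mono) auto
  moreover have "norm ?q \<le> 1 + sqrt pi * norm z"
    using norm_triangle_ineq[of 1 "of_real (sqrt pi) * z"] by (simp add: norm_mult)
  then have "exp (y\<^sup>2 - x\<^sup>2) / norm ?q \<ge> exp (y\<^sup>2 - x\<^sup>2) / (1 + sqrt pi * norm z)"
    using q_pos by (intro frac_le) auto
  moreover have "norm (erfc z) \<le> exp (y\<^sup>2 - x\<^sup>2)"
    using norm_erfc_le[of z] assms(2) z e by simp
  ultimately show ?thesis
    unfolding q by simp
qed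

end
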